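(* Let $K\subsetneq L$ be a field extension and let $A,B\subseteq L$ be $n$-dimensional $K$-subspaces with $0 < n < \infty$ and $1\notin B$. Let $\ell\ge 0$ be an integer. Then $\delta(A,B)>\ell$ if and only if there exists a nonzero $K$-subspace $R\subseteq B$ such that $A$ and $B$ admit decompositions into $K$-subspaces $$A = S \oplus Y,\qquad B = R \oplus Z,$$ where $\dim Y<\dim R -\ell$ and $$S=\bigoplus_{i=1}^m a_iK(R)$$ for some $a_1, \ldots ,a_m \in S$.
   Context: Fields are commutative. All dimensions are over $K$ unless indicated otherwise. All direct sums are internal. $[n]=\{1,\dots,n\}$, and $\langle X\rangle$ denotes the $K$-span of a set $X$. For a subset $R\subseteq L$, $K(R)$ is the smallest subfield of $L$ containing $K\cup R$. Definition (partial matching of bases). Let $A,B$ be $n$-dimensional $K$-subspaces of $L$, $n\ge 1$, and $0\le d\le n$ an integer. An ordered basis $\mathcal{A}=\{a_1,\dots,a_n\}$ of $A$ is partially matched to an ordered basis $\mathcal{B}=\{b_1,\dots,b_n\}$ of $B$ with defect $d$ if there exists $P\subseteq[n]$ with $|P|=n-d$ such that $$a_i^{-1}A\cap B\subseteq \langle b_1,\dots,b_{i-1},b_{i+1},\dots,b_n\rangle\quad\text{for each } i\in P.$$ Definition (partial matching of subspaces). $A$ is partially matched to $B$ with defect $d$ if for every ordered basis $\mathcal{A}$ of $A$ there exists an ordered basis $\mathcal{B}$ of $B$ such that $\mathcal{A}$ is partially matched to $\mathcal{B}$ with defect $d$. Definition (deficiency). For $n$-dimensional $A,B$ with $0<n<\infty$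 and $1\notin B$, $\delta(A,B)$ is the least nonnegative integer $d$ for which $A$ is partially matched to $B$ with defect $d$. *)

theory Defs
  imports Complex_Main
begin

text \<open>
  A field extension \<open>L/K\<close> is given by types \<open>'k\<close> for \<open>K\<close> and \<open>'l\<close> for \<open>L\<close> with a unital ring
  homomorphism \<open>emb\<close> from \<open>K\<close> to \<open>L\<close> (automatically injective); the copy of \<open>K\<close> inside \<open>L\<close> is
  \<open>range emb\<close>. Linear algebra over \<open>K\<close> is that of the locale \<^locale>\<open>vector_space\<close> for the
  scalar multiplication \<open>\<lambda>c x. emb c * x\<close>.
\<close>

locale field_extension =
  fixes emb :: "'k::field \<Rightarrow> 'l::field"
  assumes emb_one: "emb 1 = 1"
    and emb_add: "emb (x + y) = emb x + emb y"
    and emb_mult: "emb (x * y) = emb x * emb y"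

sublocale field_extension \<subseteq> vector_space "\<lambda>c x. emb c * x"
  by unfold_locales (simp_all add: emb_one emb_add emb_mult algebra_simps)

abbreviation K_subspace :: "('k::field \<Rightarrow> 'l::field) \<Rightarrow> 'l set \<Rightarrow> bool" where
  "K_subspace emb \<equiv> module.subspace (\<lambda>c x. emb c * x)"

abbreviation K_span :: "('k::field \<Rightarrow> 'l::field) \<Rightarrow> 'l set \<Rightarrow> 'l set" where
  "K_span emb \<equiv> module.span (\<lambda>c x. emb c * x)"

abbreviation K_independent :: "('k::field \<Rightarrow> 'l::field) \<Rightarrow> 'l set \<Rightarrow> bool" where
  "K_independent emb X \<equiv> \<not> module.dependent (\<lambda>c x. emb c * x) X"

text \<open>This is \<open>0\<close> on infinite-dimensional subspaces, so \<open>K_dim emb V = n\<close> with \<open>0 < n\<close> includes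
  finite-dimensionality of \<open>V\<close>.\<close>

abbreviation K_dim :: "('k::field \<Rightarrow> 'l::field) \<Rightarrow> 'l set \<Rightarrow> nat" where
  "K_dim emb \<equiv> vector_space.dim (\<lambda>c x. emb c * x)"

definition is_subfield :: "'l::field set \<Rightarrow> bool" where
  "is_subfield F \<longleftrightarrow> 0 \<in> F \<and> 1 \<in> F \<and>
     (\<forall>x\<in>F. \<forall>y\<in>F. x - y \<in> F \<and> x * y \<in> F) \<and> (\<forall>x\<in>F. inverse x \<in> F)"

text \<open>The field \<open>K(R)\<close>.\<close>

definition adjoin :: "('k::field \<Rightarrow> 'l::field) \<Rightarrow> 'l set \<Rightarrow> 'l set" where
  "adjoin emb R = \<Inter> {F. is_subfield F \<and> range emb \<union> R \<subseteq> F}"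

text \<open>\<open>V = U \<oplus> W\<close> and \<open>V = \<Oplus>i\<in>I. U i\<close>, internally; \<open>I\<close> is finite and the summands are
  additive subgroups wherever these are used.\<close>

definition direct_sum2 :: "'l::field set \<Rightarrow> 'l set \<Rightarrow> 'l set \<Rightarrow> bool" where
  "direct_sum2 V U W \<longleftrightarrow> V = {u + w | u w. u \<in> U \<and> w \<in> W} \<and> U \<inter> W = {0}"

definition direct_sum :: "'l::field set \<Rightarrow> 'i set \<Rightarrow> ('i \<Rightarrow> 'l set) \<Rightarrow> bool" where
  "direct_sum V I U \<longleftrightarrow>
     V = {\<Sum>i\<in>I. x i | x. \<forall>i\<in>I. x i \<in> U i} \<and>
     (\<forall>x. (\<forall>i\<in>I. x i \<in> U i) \<and> (\<Sum>i\<in>I. x i) = 0 \<longrightarrow> (\<forall>i\<in>I. x i = 0))"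

text \<open>Ordered bases are indexed by \<open>{1..n}\<close>; values elsewhere are irrelevant.\<close>

definition ordered_basis :: "('k::field \<Rightarrow> 'l::field) \<Rightarrow> nat \<Rightarrow> (nat \<Rightarrow> 'l) \<Rightarrow> 'l set \<Rightarrow> bool" where
  "ordered_basis emb n a V \<longleftrightarrow>
     inj_on a {1..n} \<and> K_independent emb (a ` {1..n}) \<and> K_span emb (a ` {1..n}) = V"

definition partially_matched_bases ::
  "('k::field \<Rightarrow> 'l::field) \<Rightarrow> nat \<Rightarrow> 'l set \<Rightarrow> 'l set \<Rightarrow> (nat \<Rightarrow> 'l) \<Rightarrow> (nat \<Rightarrow> 'l) \<Rightarrow> nat \<Rightarrow> bool" where
  "partially_matched_bases emb n A B a b d \<longleftrightarrow>
     (\<exists>P \<subseteq> {1..n}. card P = n - d \<and>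
        (\<forall>i\<in>P. (\<lambda>x. inverse (a i) * x) ` A \<inter> B \<subseteq> K_span emb (b ` ({1..n} - {i}))))"

definition partially_matched ::
  "('k::field \<Rightarrow> 'l::field) \<Rightarrow> nat \<Rightarrow> 'l set \<Rightarrow> 'l set \<Rightarrow> nat \<Rightarrow> bool" where
  "partially_matched emb n A B d \<longleftrightarrow> d \<le> n \<and>
     (\<forall>a. ordered_basis emb n a A \<longrightarrow>
        (\<exists>b. ordered_basis emb n b B \<and> partially_matched_bases emb n A B a b d))"

text \<open>Only meant for \<open>A\<close> and \<open>B\<close> of the same positive finite dimension with \<open>1 \<notin> B\<close>; then the
  defect \<open>K_dim emb A\<close> is always attained, so the least element exists.\<close>

definition deficiency :: "('k::field \<Rightarrow> 'l::field) \<Rightarrow> 'l set \<Rightarrow> 'l set \<Rightarrow> nat" where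
  "deficiency emb A B = (LEAST d. partially_matched emb (K_dim emb A) A B d)"

end

theory Submission
  imports Defs
begin

text \<open>
  By the defect form of Rado's theorem, applied to the annihilators of the \<open>a\<^sub>i\<^sup>-\<^sup>1A \<inter> B\<close> in the dual of
  \<open>B\<close>, a basis \<open>a\<close> of \<open>A\<close> fails to be partially matched with defect \<open>\<ell>\<close> iff for some \<open>J\<close> the
  intersection of the \<open>a\<^sub>i\<^sup>-\<^sup>1A \<inter> B\<close> with \<open>i \<in> J\<close> has dimension greater than \<open>n - |J| + \<ell>\<close>. Hence
  \<open>\<delta>(A, B) > \<ell>\<close> iff there are subspaces \<open>U \<subseteq> A\<close> and \<open>R \<subseteq> B\<close> with \<open>UR \<subseteq> A\<close> and
  \<open>dim U + dim R > n + \<ell>\<close>. Dyson transforms turn such a pair into one with \<open>UR \<subseteq> U\<close>, that is, into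
  one where \<open>U\<close> is a vector space over \<open>K(R)\<close>.
\<close>

section \<open>Finite-dimensional subspaces\<close>

text \<open>A copy of \<^locale>\<open>vector_space\<close> whose new names are not captured by the global
  interpretation \<open>real_vector\<close>.\<close>

locale linear_space = vector_space scale
  for scale :: "'a::field \<Rightarrow> 'b::ab_group_add \<Rightarrow> 'b" (infixr "*s" 75)
begin

definition fin_dim :: "'b set \<Rightarrow> bool" where
  "fin_dim V \<longleftrightarrow> (\<exists>F. finite F \<and> V \<subseteq> span F)"

lemma fin_dim_subset: "fin_dim W \<Longrightarrow> V \<subseteq> W \<Longrightarrow> fin_dim V"
  unfolding fin_dim_def by blast

lemma fin_dim_independent:
  assumes "fin_dim V" "T \<subseteq> V" "independent T"
  shows "finite T" "card T \<le> dim V"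
proof -
  obtain F where F: "finite F" "V \<subseteq> span F"
    using assms(1) unfolding fin_dim_def by blast
  then show "finite T"
    using independent_span_bound[of F T] assms by blast
  obtain X where X: "X \<subseteq> V" "independent X" "V \<subseteq> span X" "card X = dim V"
    by (rule basis_exists)
  have "finite X"
    using independent_span_bound[of F X] F X by blast
  then show "card T \<le> dim V"
    using independent_span_bound[of X T] assms X by auto
qed

lemma fin_dim_basis_extend:
  assumes "fin_dim V" "subspace V" "X \<subseteq> V" "independent X"
  obtains T where "X \<subseteq> T" "T \<subseteq> V" "independent T" "finite T" "span T = V" "card T = dim V"
proof -
  obtain T where T: "X \<subseteq> T" "T \<subseteq> V" "independent T" "V \<subseteq> span T"
    by (rule maximal_independent_subset_extend[OF assms(3,4)])
  show ?thesis
    by (rule that[OF T(1-3) fin_dim_independent(1)[OF assms(1) T(2,3)] span_subspace[OF T(2,4) assms(2)]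
          basis_card_eq_dim[OF T(2,4,3)]])
qed

lemma fin_dim_basis:
  assumes "fin_dim V" "subspace V"
  obtains T where "T \<subseteq> V" "independent T" "finite T" "span T = V" "card T = dim V"
  by (rule fin_dim_basis_extend[OF assms empty_subsetI independent_empty])

lemma fin_dim_if_dim_pos:
  assumes "0 < dim V"
  shows "fin_dim V"
proof -
  obtain X where "X \<subseteq> V" "independent X" "V \<subseteq> span X" "card X = dim V"
    by (rule basis_exists)
  then show ?thesis
    using assms card_gt_0_iff[of X] unfolding fin_dim_def by auto
qed

lemma fin_dim_dim_mono:
  assumes "fin_dim W" "V \<subseteq> W"
  shows "dim V \<le> dim W"
proof -
  obtain X where X: "X \<subseteq> V" "independent X" "V \<subseteq> span X" "card X = dim V"
    by (rule basis_exists)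
  then show ?thesis
    using fin_dim_independent(2)[OF assms(1), of X] assms(2) by simp
qed

lemma fin_dim_dim_insert_less:
  assumes "fin_dim W" "subspace V" "V \<subseteq> W" "x \<in> W" "x \<notin> V"
  shows "dim V < dim W"
proof -
  obtain T where T: "T \<subseteq> V" "independent T" "finite T" "span T = V" "card T = dim V"
    using fin_dim_basis fin_dim_subset assms by metis
  have "independent (insert x T)"
    using T assms by (simp add: independent_insert)
  moreover have "x \<notin> T"
    using T assms by blast
  moreover have "insert x T \<subseteq> W"
    using T assms by blast
  ultimately show ?thesis
    using fin_dim_independent(2)[of W "insert x T"] T assms by auto
qed

lemma fin_dim_subspace_eq:
  assumes "fin_dim W" "subspace V" "V \<subseteq> W" "dim W \<le> dim V"
  shows "V = W"
  using fin_dim_dim_insert_less[of W V] assms by (meson not_less subsetI subset_antisym)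

lemma dim_sum_le:
  assumes "fin_dim U" "fin_dim W" "subspace U" "subspace W"
  shows "dim {u + w | u w. u \<in> U \<and> w \<in> W} \<le> dim U + dim W"
proof -
  obtain S where S: "finite S" "span S = U" "card S = dim U"
    using fin_dim_basis assms by metis
  obtain T where T: "finite T" "span T = W" "card T = dim W"
    using fin_dim_basis assms by metis
  have "dim {u + w | u w. u \<in> U \<and> w \<in> W} \<le> card (S \<union> T)"
    using S T by (intro dim_le_card) (auto simp: span_Un)
  also have "\<dots> \<le> card S + card T"
    by (rule card_Un_le)
  finally show ?thesis
    using S T by simp
qed

text \<open>Extend a basis \<open>X\<close> of \<open>U \<inter> W\<close> to bases \<open>S\<close>
  of \<open>U\<close> and \<open>T\<close> of \<open>W\<close>; then
  \<open>S \<union> (T - X)\<close> is independent. Bounding the sums by an arbitrary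
  \<open>V\<close> gives submodularity of the dimension without naming the sum.\<close>

lemma dim_add_le_dim_sum_Int:
  assumes "fin_dim V" "subspace U" "subspace W" "U \<subseteq> V" "W \<subseteq> V"
    and sum: "\<And>u w. u \<in> U \<Longrightarrow> w \<in> W \<Longrightarrow> u + w \<in> V"
  shows "dim U + dim W \<le> dim V + dim (U \<inter> W)"
proof -
  have fin: "fin_dim U" "fin_dim W" "fin_dim (U \<inter> W)"
    using assms fin_dim_subset by blast+
  obtain X where X: "X \<subseteq> U \<inter> W" "independent X" "finite X" "span X = U \<inter> W" "card X = dim (U \<inter> W)"
    using fin_dim_basis[OF fin(3)] subspace_inter assms by metis
  obtain S where S: "X \<subseteq> S" "S \<subseteq> U" "independent S" "finite S" "span S = U" "card S = dim U"
    using fin_dim_basis_extend[OF fin(1), of X] X assms by blast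
  obtain T where T: "X \<subseteq> T" "T \<subseteq> W" "independent T" "finite T" "span T = W" "card T = dim W"
    using fin_dim_basis_extend[OF fin(2), of X] X assms by blast
  \<comment> \<open>Elements of \<open>T - X\<close> are added one at a time: if
    \<open>z = u + w\<close> with \<open>u\<close> in \<open>U\<close> and \<open>w\<close> in
    \<open>span Z\<close>, then \<open>u = z - w\<close> lies in
    \<open>U \<inter> W = span X\<close>, so \<open>z\<close> depends on other elements of
    \<open>T\<close>.\<close>
  have *: "independent (S \<union> Z) \<and> S \<inter> Z = {}" if "finite Z" "Z \<subseteq> T - X" for Z
    using that
  proof (induction Z)
    case empty
    then show ?case using S by simp
  next
    case (insert z Z)
    have "z \<notin> span (S \<union> Z)"
    proof
      assume "z \<in> span (S \<union> Z)"
      then obtain u w where uw: "z = u + w" "u \<in> U" "w \<in> span Z"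
        using S by (auto simp: span_Un)
      have "span Z \<subseteq> W"
        using span_mono[of Z T] insert.prems T by blast
      then have "z \<in> W" "w \<in> W"
        using T uw insert.prems by auto
      then have "z - w \<in> W"
        using subspace_diff assms(3) by blast
      then have "u \<in> span X"
        using uw X by simp
      then have "z \<in> span (X \<union> Z)"
        using uw by (auto simp: span_Un)
      moreover have "X \<union> Z \<subseteq> T - {z}"
        using insert T by blast
      ultimately have "z \<in> span (T - {z})"
        using span_mono by blast
      then show False
        using T insert.prems by (auto simp: dependent_def)
    qed
    then show ?case
      using insert span_superset[of "S \<union> Z"] by (auto simp: independent_insert)
  qed
  have "S \<union> (T - X) \<subseteq> V"
    using S T assms by blast
  then have "card (S \<union> (T - X)) \<le> dim V"
    using fin_dim_independent(2)[OF assms(1)] * T by blast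
  moreover have "card (S \<union> (T - X)) = card S + card (T - X)"
    using * S T by (intro card_Un_disjoint) auto
  moreover have "card (T - X) = card T - card X" "card X \<le> card T"
    using T X card_mono[of T X] by (auto simp: card_Diff_subset)
  ultimately show ?thesis
    using S T X by simp
qed

text \<open>A common vector has only one representation over \<open>S \<union> T\<close>, and its
  support lies in both \<open>S\<close> and \<open>T\<close>.\<close>

lemma span_Int_span_independent:
  assumes "independent (S \<union> T)" "S \<inter> T = {}"
  shows "span S \<inter> span T = {0}"
proof -
  have "x = 0" if "x \<in> span S" "x \<in> span T" for x
  proof -
    have "representation (S \<union> T) x = representation S x"
      "representation (S \<union> T) x = representation T x"
      using assms that by (auto intro!: representation_extend)
    then have "representation S x b = 0" for b
      using representation_ne_zero[of S x b] representation_ne_zero[of T x b] assms(2) by auto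
    then show ?thesis
      using sum_nonzero_representation_eq[of S x] that independent_mono[OF assms(1)] by simp
  qed
  then show ?thesis
    using span_zero by blast
qed

lemma subspace_complement:
  assumes "fin_dim V" "subspace V" "subspace U" "U \<subseteq> V"
  obtains W where "subspace W" "V = {u + w | u w. u \<in> U \<and> w \<in> W}" "U \<inter> W = {0}"
    "dim U + dim W = dim V"
proof -
  obtain S where S: "S \<subseteq> U" "independent S" "finite S" "span S = U" "card S = dim U"
    using fin_dim_basis fin_dim_subset assms by metis
  obtain T where T: "S \<subseteq> T" "T \<subseteq> V" "independent T" "finite T" "span T = V" "card T = dim V"
    using fin_dim_basis_extend[of V S] S assms by blast
  have un: "S \<union> (T - S) = T"
    using T by blast
  show ?thesis
  proof
    show "subspace (span (T - S))"
      by simp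
    show "V = {u + w | u w. u \<in> U \<and> w \<in> span (T - S)}"
      using span_Un[of S "T - S"] un T S by simp
    show "U \<inter> span (T - S) = {0}"
      using span_Int_span_independent[of S "T - S"] un T S by auto
    have "dim (span (T - S)) = card (T - S)"
      using T independent_mono[of T "T - S"] by (intro dim_span_eq_card_independent) auto
    also have "\<dots> = card T - card S"
      using T S by (simp add: card_Diff_subset)
    finally show "dim U + dim (span (T - S)) = dim V"
      using S T card_mono[of T S] by simp
  qed
qed

text \<open>By uniqueness of coordinates, each \<open>y\<close> in \<open>Y\<close> has coefficient
  zero in \<open>x\<close>. This turns several hyperplane conditions into one bound on a
  dimension.\<close>

lemma mem_span_Diff:
  assumes X: "independent X" and x: "x \<in> span X" "\<And>y. y \<in> Y \<Longrightarrow> x \<in> span (X - {y})"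
  shows "x \<in> span (X - Y)"
proof -
  have "y \<notin> Y" if y: "representation X x y \<noteq> 0" for y
  proof
    assume "y \<in> Y"
    then have "representation X x = representation (X - {y}) x"
      using X x(2) by (intro representation_extend) auto
    then show False
      using y representation_ne_zero[of "X - {y}" x y] by auto
  qed
  then have "(\<Sum>y | representation X x y \<noteq> 0. representation X x y *s y) \<in> span (X - Y)"
    using representation_ne_zero[of X x] by (intro span_sum span_scale span_base) auto
  then show ?thesis
    using sum_nonzero_representation_eq[OF X x(1)] by simp
qed


section \<open>Rado's theorem with defect\<close>

lemma independent_if_card_le_dim:
  assumes "finite X" "V \<subseteq> span X" "card X \<le> dim V"
  shows "independent X"
proof
  assume "dependent X"
  then obtain a where a: "a \<in> X" "a \<in> span (X - {a})"
    by (auto simp: dependent_def)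
  then have "span (X - {a}) = span X"
    using span_redundant[of a "X - {a}"] by (simp add: insert_absorb)
  then have "dim V \<le> card (X - {a})"
    using assms by (intro dim_le_card) auto
  then show False
    using assms a by (metis card_Diff1_less leD le_trans)
qed

lemma subspace_scale_eq_0:
  assumes "subspace V" "k *s v \<in> V" "v \<notin> V"
  shows "k = 0"
proof (rule ccontr)
  assume "k \<noteq> 0"
  moreover have "inverse k *s k *s v \<in> V"
    using assms subspace_scale by blast
  ultimately show False
    using assms(3) by simp
qed

text \<open>If \<open>z\<close> differs from a multiple \<open>h *s y\<close> by an element of
  \<open>V\<close> and also lies in the first span, then so does \<open>h *s y\<close>, which forces
  \<open>h = 0\<close>.\<close>

lemma span_insert_Int_span_insert:
  assumes "subspace V" "y \<notin> span (insert x V)"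
  shows "span (insert x V) \<inter> span (insert y V) \<subseteq> V"
proof
  fix z assume "z \<in> span (insert x V) \<inter> span (insert y V)"
  then obtain h where z: "z \<in> span (insert x V)" "z - h *s y \<in> V"
    using span_breakdown_eq[of z y V] span_eq_iff[THEN iffD2, OF assms(1)] by auto
  have "V \<subseteq> span (insert x V)"
    by (simp add: span_superset subset_insertI2 span_base subsetI)
  then have "z - (z - h *s y) \<in> span (insert x V)"
    using z span_diff by blast
  then have "h *s y \<in> span (insert x V)"
    by simp
  then have "h = 0"
    using assms(2) subspace_scale_eq_0 by blast
  then show "z \<in> V"
    using z by simp
qed

text \<open>For \<open>card I = dim B\<close> the inequality is Rado's condition with defect
  \<open>l\<close> in the dual of \<open>B\<close>: the annihilators of the \<open>V j\<close> with
  \<open>j\<close> in \<open>J\<close> span a space of dimension at least \<open>card J - l\<close>.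
  Intersecting with \<open>B\<close> gives the empty \<open>J\<close> its meaning.\<close>

definition rado_family :: "'b set \<Rightarrow> 'i set \<Rightarrow> nat \<Rightarrow> ('i \<Rightarrow> 'b set) \<Rightarrow> bool" where
  "rado_family B I l V \<longleftrightarrow> (\<forall>i\<in>I. subspace (V i) \<and> V i \<subseteq> B) \<and>
     (\<forall>J\<subseteq>I. dim (B \<inter> (\<Inter>i\<in>J. V i)) + card J \<le> card I + l)"

text \<open>By submodularity of the dimension, violations for the two enlarged families would combine to
  one for \<open>V\<close>.\<close>

lemma rado_family_enlarge:
  assumes B: "fin_dim B" "subspace B" and I: "finite I" and V: "rado_family B I l V" "i \<in> I"
    and x: "x \<in> B" and y: "y \<in> B" "y \<notin> span (insert x (V i))"
  shows "rado_family B I l (V(i := span (insert x (V i)))) \<or>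
         rado_family B I l (V(i := span (insert y (V i))))"
proof (rule ccontr)
  define W where "W J = B \<inter> (\<Inter>j\<in>J. V j)" for J
  have Vi: "subspace (V i)" "V i \<subseteq> B"
    and Vsub: "\<And>j. j \<in> I \<Longrightarrow> subspace (V j) \<and> V j \<subseteq> B"
    and Vdim: "\<And>J. J \<subseteq> I \<Longrightarrow> dim (W J) + card J \<le> card I + l"
    using V by (auto simp: rado_family_def W_def)
  have W: "subspace (W J)" "fin_dim (W J)" if "J \<subseteq> I" for J
    using that Vsub B fin_dim_subset[of B "W J"] unfolding W_def
    by (auto intro!: subspace_inter subspace_Int)
  \<comment> \<open>As \<open>V\<close> itself satisfies the condition, a violating index set must
    contain \<open>i\<close>. It is split off from \<open>J\<close>, and \<open>Suc\<close> counts
    it back in.\<close>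
  have bad: "\<exists>J\<subseteq>I - {i}. card I + l < dim (span (insert z (V i)) \<inter> W J) + Suc (card J)"
    if "\<not> rado_family B I l (V(i := span (insert z (V i))))" "z \<in> B" for z
  proof -
    have "span (insert z (V i)) \<subseteq> B"
      using that Vi B by (intro span_minimal) auto
    define U where "U = V(i := span (insert z (V i)))"
    have "\<forall>j\<in>I. subspace (U j) \<and> U j \<subseteq> B"
      using Vsub \<open>span (insert z (V i)) \<subseteq> B\<close> by (simp add: U_def)
    moreover have "\<not> rado_family B I l U"
      using that(1) by (simp add: U_def)
    ultimately obtain J where J: "J \<subseteq> I" "\<not> dim (B \<inter> (\<Inter>j\<in>J. U j)) + card J \<le> card I + l"
      unfolding rado_family_def by blast
    have "i \<in> J"
    proof (rule ccontr)
      assume "i \<notin> J"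
      then have "(\<Inter>j\<in>J. U j) = (\<Inter>j\<in>J. V j)"
        by (intro INF_cong) (auto simp: U_def)
      then show False
        using J Vdim[of J] by (simp add: W_def)
    qed
    then have "B \<inter> (\<Inter>j\<in>J. U j) = span (insert z (V i)) \<inter> W (J - {i})"
      using \<open>span (insert z (V i)) \<subseteq> B\<close> by (auto simp: W_def U_def split: if_splits)
    moreover have "card J = Suc (card (J - {i}))"
      using \<open>i \<in> J\<close> J(1) I by (metis card.remove finite_subset)
    ultimately show ?thesis
      using J by (intro exI[of _ "J - {i}"]) auto
  qed
  assume "\<not> ?thesis"
  then obtain J J' where J: "J \<subseteq> I - {i}" "card I + l < dim (span (insert x (V i)) \<inter> W J) + Suc (card J)"
    and J': "J' \<subseteq> I - {i}" "card I + l < dim (span (insert y (V i)) \<inter> W J') + Suc (card J')"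
    using bad[of x] bad[of y] x y by blast
  let ?P = "span (insert x (V i)) \<inter> W J" and ?Q = "span (insert y (V i)) \<inter> W J'"
  have sub: "J \<inter> J' \<subseteq> I" "insert i (J \<union> J') \<subseteq> I" "J \<subseteq> I" "J' \<subseteq> I"
    using J J' V by auto
  have PQ: "subspace ?P" "subspace ?Q" "?P \<subseteq> W (J \<inter> J')" "?Q \<subseteq> W (J \<inter> J')"
    using subspace_inter[OF subspace_span W(1)] sub by (auto simp: W_def)
  \<comment> \<open>Two violations make \<open>dim ?P + dim ?Q + card J + card J'\<close> at least
    \<open>2 * (card I + l)\<close>. The conditions of \<open>V\<close> for
    \<open>J \<inter> J'\<close> and \<open>insert i (J \<union> J')\<close> bound it by one less,
    since \<open>i\<close> is counted in the second set.\<close>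
  have "dim ?P + dim ?Q \<le> dim (W (J \<inter> J')) + dim (?P \<inter> ?Q)"
  proof (rule dim_add_le_dim_sum_Int[OF _ PQ])
    show "fin_dim (W (J \<inter> J'))"
      using W sub by blast
    show "u + w \<in> W (J \<inter> J')" if "u \<in> ?P" "w \<in> ?Q" for u w
      using that PQ(3,4) subspace_add[OF W(1)[OF sub(1)]] by blast
  qed
  moreover have "?P \<inter> ?Q \<subseteq> W (insert i (J \<union> J'))"
    using span_insert_Int_span_insert[OF Vi(1) y(2)] by (auto simp: W_def)
  then have "dim (?P \<inter> ?Q) \<le> dim (W (insert i (J \<union> J')))"
    using fin_dim_dim_mono W sub by blast
  moreover have "card (insert i (J \<union> J')) = Suc (card (J \<union> J'))"
    using J J' I by (intro card_insert_disjoint) (auto intro: finite_subset)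
  moreover have "card (J \<union> J') + card (J \<inter> J') = card J + card J'"
    using card_Un_Int[of J J'] sub I finite_subset by metis
  ultimately show False
    using Vdim[OF sub(1)] Vdim[OF sub(2)] J(2) J'(2) by linarith
qed

text \<open>Among the admissible enlargements of \<open>V\<close>, take one with the largest sum of
  dimensions. If some \<open>V' i\<close> had codimension at least two in \<open>B\<close>, one of
  two vectors independent modulo \<open>V' i\<close> could be added to it by
  \<open>rado_family_enlarge\<close>.\<close>

lemma rado_family_maximal:
  assumes B: "fin_dim B" "subspace B" and I: "finite I" and V: "rado_family B I l V"
  obtains V' where "rado_family B I l V'" "\<And>i. i \<in> I \<Longrightarrow> V i \<subseteq> V' i"
    "\<And>i x y. i \<in> I \<Longrightarrow> x \<in> B \<Longrightarrow> x \<notin> V' i \<Longrightarrow> y \<in> B \<Longrightarrow> y \<in> span (insert x (V' i))"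
proof -
  define Q where "Q V' \<longleftrightarrow> rado_family B I l V' \<and> (\<forall>i\<in>I. V i \<subseteq> V' i)" for V'
  have sub: "V' j \<subseteq> B \<and> subspace (V' j)" if "Q V'" "j \<in> I" for V' j
    using that by (auto simp: Q_def rado_family_def)
  have "Q V"
    using V by (simp add: Q_def)
  moreover have "\<forall>V'. Q V' \<longrightarrow> (\<Sum>i\<in>I. dim (V' i)) < Suc (\<Sum>i\<in>I. dim B)"
    using fin_dim_dim_mono[OF B(1)] sub unfolding less_Suc_eq_le by (blast intro!: sum_mono)
  ultimately have "\<exists>V'. Q V' \<and> (\<forall>V''. Q V'' \<longrightarrow> (\<Sum>i\<in>I. dim (V'' i)) \<le> (\<Sum>i\<in>I. dim (V' i)))"
    by (rule ex_has_greatest_nat)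
  then obtain V' where V': "Q V'"
    and max: "\<And>V''. Q V'' \<Longrightarrow> (\<Sum>i\<in>I. dim (V'' i)) \<le> (\<Sum>i\<in>I. dim (V' i))"
    by blast
  have not_enlarged: "\<not> rado_family B I l (V'(i := span (insert z (V' i))))"
    if "i \<in> I" "z \<in> B" "z \<notin> V' i" for i z
  proof
    let ?S = "span (insert z (V' i))"
    assume rado: "rado_family B I l (V'(i := ?S))"
    have ins: "V' i \<subseteq> ?S" "z \<in> ?S"
      using span_superset by blast+
    have "?S \<subseteq> B"
      using sub[OF V' that(1)] that B by (intro span_minimal) auto
    then have "dim (V' i) < dim ?S"
      using fin_dim_dim_insert_less[of ?S "V' i" z] fin_dim_subset[OF B(1)] ins that sub[OF V' that(1)]
      by blast
    then have "(\<Sum>j\<in>I. dim (V' j)) < (\<Sum>j\<in>I. dim ((V'(i := ?S)) j))"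
      using I that by (intro sum_strict_mono_ex1) auto
    moreover have "Q (V'(i := ?S))"
      using V' rado ins by (auto simp: Q_def)
    ultimately show False
      using max by (meson leD)
  qed
  have "y \<in> span (insert x (V' i))" if "i \<in> I" "x \<in> B" "x \<notin> V' i" "y \<in> B" for i x y
  proof (rule ccontr)
    assume y: "y \<notin> span (insert x (V' i))"
    then have "y \<notin> V' i"
      by (meson insertCI span_base)
    have rado: "rado_family B I l V'"
      using V' by (simp add: Q_def)
    show False
      using rado_family_enlarge[OF B I rado that(1,2,4) y] not_enlarged that \<open>y \<notin> V' i\<close> by blast
  qed
  with V' show ?thesis
    using that[of V'] by (auto simp: Q_def)
qed

text \<open>The conclusion says that the \<open>i\<close>-th coordinate functional of \<open>b\<close> annihilates \<open>V i\<close>: this is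
  Rado's theorem on independent transversals, with defect \<open>l\<close>, for the annihilators of the \<open>V i\<close>
  in the dual of \<open>B\<close>.\<close>

lemma rado_hyperplanes:
  assumes B: "fin_dim B" "subspace B" and I: "finite I" "card I = dim B"
    and V: "rado_family B I l V"
  obtains b P where "inj_on b I" "independent (b ` I)" "span (b ` I) = B"
    "P \<subseteq> I" "card P = dim B - l" "\<And>i. i \<in> P \<Longrightarrow> V i \<subseteq> span (b ` (I - {i}))"
proof -
  obtain V' where V': "rado_family B I l V'" and VV': "\<And>i. i \<in> I \<Longrightarrow> V i \<subseteq> V' i"
    and hyper: "\<And>i x y. i \<in> I \<Longrightarrow> x \<in> B \<Longrightarrow> x \<notin> V' i \<Longrightarrow> y \<in> B \<Longrightarrow> y \<in> span (insert x (V' i))"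
    using rado_family_maximal[OF B I(1) V] by blast
  define W where "W J = B \<inter> (\<Inter>j\<in>J. V' j)" for J
  have sub: "\<And>j. j \<in> I \<Longrightarrow> subspace (V' j)"
    and dim: "dim (W I) + card I \<le> card I + l"
    using V' by (auto simp: rado_family_def W_def)
  have W: "subspace (W J)" "fin_dim (W J)" if "J \<subseteq> I" for J
    using that sub B fin_dim_subset[of B "W J"] unfolding W_def
    by (auto intro!: subspace_inter subspace_Int)
  \<comment> \<open>By minimality of \<open>P\<close>, dropping any \<open>i\<close> enlarges the
    intersection. This yields vectors \<open>p i\<close> outside \<open>V' i\<close> but inside all
    other \<open>V' j\<close> with \<open>j\<close> in \<open>P\<close>, a system dual to these
    hyperplanes.\<close>
  obtain P where "(P \<subseteq> I \<and> W P = W I) \<and> (\<forall>P'. P' \<subseteq> I \<and> W P' = W I \<longrightarrow> card P \<le> card P')"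
    using ex_has_least_nat[of "\<lambda>P. P \<subseteq> I \<and> W P = W I" I card] by auto
  then have P: "P \<subseteq> I" "W P = W I"
    and least: "\<And>P'. P' \<subseteq> I \<Longrightarrow> W P' = W I \<Longrightarrow> card P \<le> card P'"
    by simp_all
  have finP: "finite P"
    using P I finite_subset by blast
  have "\<exists>x. x \<in> W (P - {i}) \<and> x \<notin> V' i" if "i \<in> P" for i
  proof -
    have "\<not> card P \<le> card (P - {i})"
      using that finP card_Diff1_less[of P i] by simp
    then have "W (P - {i}) \<noteq> W I"
      using least[of "P - {i}"] P by blast
    moreover have "W (P - {i}) \<inter> V' i = W I"
      using that P(2) by (auto simp: W_def)
    ultimately show ?thesis
      by blast
  qed
  then obtain p where p: "\<And>i. i \<in> P \<Longrightarrow> p i \<in> W (P - {i})" "\<And>i. i \<in> P \<Longrightarrow> p i \<notin> V' i"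
    by metis
  then have pB: "\<And>i. i \<in> P \<Longrightarrow> p i \<in> B"
    and pV: "\<And>i j. i \<in> P \<Longrightarrow> j \<in> P \<Longrightarrow> i \<noteq> j \<Longrightarrow> p i \<in> V' j"
    by (auto simp: W_def)
  \<comment> \<open>Each new index lowers the dimension of \<open>W F\<close>, because
    \<open>p i\<close> is lost.\<close>
  have dim_W: "dim (W F) + card F \<le> dim B" if "finite F" "F \<subseteq> P" for F
    using that
  proof (induction F)
    case empty
    then show ?case by (simp add: W_def)
  next
    case (insert i F)
    have "p i \<in> V' j" if "j \<in> F" for j
      using pV[of i j] insert that by blast
    then have "p i \<in> W F" "p i \<notin> W (insert i F)" "W (insert i F) \<subseteq> W F"
      using insert p pB by (auto simp: W_def)
    moreover have "insert i F \<subseteq> I" "F \<subseteq> I"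
      using insert.prems P(1) by auto
    ultimately have "dim (W (insert i F)) < dim (W F)"
      using fin_dim_dim_insert_less[of "W F" "W (insert i F)" "p i"] W by blast
    then show ?case
      using insert by auto
  qed
  obtain C where C: "C \<subseteq> W I" "independent C" "finite C" "span C = W I" "card C = dim (W I)"
    using fin_dim_basis W by blast
  \<comment> \<open>Since \<open>V' i\<close> has codimension at most one, subtracting a multiple of
    \<open>p i\<close> moves \<open>x\<close> into \<open>V' i\<close>. The corrections do not
    disturb one another, as \<open>p i\<close> lies in the other \<open>V' j\<close>, so the
    remainder is in \<open>W P = W I\<close>.\<close>
  have span_pC: "B \<subseteq> span (p ` P \<union> C)"
  proof
    fix x assume x: "x \<in> B"
    have "\<forall>i\<in>P. \<exists>k. x - k *s p i \<in> V' i"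
    proof
      fix i assume "i \<in> P"
      then have "x \<in> span (insert (p i) (V' i))" "span (V' i) = V' i"
        using hyper[of i "p i" x] P(1) p(2) pB x sub[of i] span_eq_iff[of "V' i"] by blast+
      then show "\<exists>k. x - k *s p i \<in> V' i"
        using span_breakdown_eq[of x "p i" "V' i"] by simp
    qed
    then obtain k where k: "\<And>i. i \<in> P \<Longrightarrow> x - k i *s p i \<in> V' i"
      using bchoice[of P "\<lambda>i k. x - k *s p i \<in> V' i"] by blast
    have "x - (\<Sum>i\<in>P. k i *s p i) \<in> W P"
    proof -
      have "(\<Sum>i\<in>P. k i *s p i) \<in> B"
        using B pB by (intro subspace_sum subspace_scale) auto
      moreover have "x - (\<Sum>i\<in>P. k i *s p i) \<in> V' j" if "j \<in> P" for j
      proof -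
        have "(\<Sum>i\<in>P. k i *s p i) = k j *s p j + (\<Sum>i\<in>P - {j}. k i *s p i)"
          using finP that by (rule sum.remove)
        then have eq: "x - (\<Sum>i\<in>P. k i *s p i) = (x - k j *s p j) - (\<Sum>i\<in>P - {j}. k i *s p i)"
          by simp
        have "subspace (V' j)"
          using sub that P by blast
        then show ?thesis
          unfolding eq
          by (rule subspace_diff) (use \<open>subspace (V' j)\<close> k pV that in \<open>auto intro!: subspace_sum subspace_scale\<close>)
      qed
      ultimately show ?thesis
        using subspace_diff[OF B(2) x] by (simp add: W_def)
    qed
    then have "x - (\<Sum>i\<in>P. k i *s p i) \<in> span (p ` P \<union> C)"
      using P(2) C(4) span_mono[of C "p ` P \<union> C"] by auto
    moreover have "(\<Sum>i\<in>P. k i *s p i) \<in> span (p ` P \<union> C)"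
      by (intro span_sum span_scale span_base) auto
    ultimately have "(x - (\<Sum>i\<in>P. k i *s p i)) + (\<Sum>i\<in>P. k i *s p i) \<in> span (p ` P \<union> C)"
      by (rule span_add)
    then show "x \<in> span (p ` P \<union> C)"
      by simp
  qed
  have "dim B \<le> card (p ` P \<union> C)"
    using span_pC C finP by (intro dim_le_card) auto
  also have "\<dots> \<le> card P + card C"
    using card_Un_le[of "p ` P" C] card_image_le[OF finP, of p] by linarith
  finally have card_PC: "card P + card C = dim B"
    using dim_W[OF finP] P(2) C(5) by simp
  then have "card (I - P) = card C"
    using I finP P(1) by (simp add: card_Diff_subset)
  then obtain g where g: "bij_betw g (I - P) C"
    using finite_same_card_bij[of "I - P" C] I C by blast
  \<comment> \<open>Indices in \<open>P\<close> carry the dual vectors; the remaining ones enumerate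
    a basis of \<open>W I\<close>, which lies in every \<open>V' j\<close>.\<close>
  define b where "b i = (if i \<in> P then p i else g i)" for i
  have "b ` I = b ` P \<union> b ` (I - P)"
    using P by blast
  also have "b ` P = p ` P"
    by (simp add: b_def)
  also have "b ` (I - P) = C"
    using g by (auto simp: b_def bij_betw_def)
  finally have bI: "b ` I = p ` P \<union> C" .
  have "b ` I \<subseteq> B"
    using pB C by (auto simp: bI W_def)
  then have span_b: "span (b ` I) = B"
    using span_pC bI B by (intro span_subspace) auto
  have card_b: "card (b ` I) \<le> card I"
    using I card_image_le by blast
  show ?thesis
  proof -
    have "dim B \<le> card (b ` I)"
      using span_b I by (intro dim_le_card) auto
    then have inj: "inj_on b I"
      using card_b I by (intro eq_card_imp_inj_on) auto
    have indep: "independent (b ` I)"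
      using span_b I card_b by (intro independent_if_card_le_dim[of _ B]) auto
    \<comment> \<open>The condition for \<open>J = I\<close> says \<open>dim (W I) \<le> l\<close>,
      while \<open>card P = dim B - dim (W I)\<close>.\<close>
    have "dim B - l \<le> card P"
      using card_PC C(5) dim by simp
    then obtain P' where P': "P' \<subseteq> P" "card P' = dim B - l"
      using obtain_subset_with_card_n by metis
    have "V i \<subseteq> span (b ` (I - {i}))" if "i \<in> P'" for i
    proof
      fix x assume "x \<in> V i"
      have i: "i \<in> P" "i \<in> I"
        using that P' P by auto
      then have x: "x \<in> V' i" "x \<in> B"
        using \<open>x \<in> V i\<close> VV' V' by (auto simp: rado_family_def)
      have "b j \<in> V' i" if j: "j \<in> I - {i}" for j
      proof (cases "j \<in> P")
        case True
        then show ?thesis using pV j i by (simp add: b_def)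
      next
        case False
        then have "b j \<in> C"
          using g j by (auto simp: b_def bij_betw_def)
        then show ?thesis
          using C(1) i by (auto simp: W_def)
      qed
      then have span_V': "span (b ` (I - {i})) \<subseteq> V' i"
        using sub i by (intro span_minimal) auto
      \<comment> \<open>The other basis vectors lie in \<open>V' i\<close> and
        \<open>b i = p i\<close> does not, so the coefficient of \<open>b i\<close> in an element of
        \<open>V' i\<close> is zero.\<close>
      have "x \<in> span (insert (b i) (b ` (I - {i})))"
        using x span_b i by (simp add: insert_absorb flip: image_insert)
      then obtain k where k: "x - k *s b i \<in> span (b ` (I - {i}))"
        using span_breakdown_eq by blast
      then have "x - (x - k *s b i) \<in> V' i"
        using span_V' x sub[OF i(2)] subspace_diff by blast
      then have "k *s b i \<in> V' i"
        by simp
      then have "k = 0"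
        using p(2)[OF i(1)] i(1) sub[OF i(2)] subspace_scale_eq_0 by (metis b_def)
      then show "x \<in> span (b ` (I - {i}))"
        using k by simp
    qed
    then show ?thesis
      using that[OF inj indep span_b _ P'(2)] P'(1) P(1) by blast
  qed
qed

end


section \<open>Stable pairs of subspaces\<close>

sublocale field_extension \<subseteq> linear_space "\<lambda>c x. emb c * x" ..

context field_extension
begin

section \<open>Multiplication by a fixed element as a linear map\<close>

lemma module_hom_mult: "module_hom (\<lambda>c x. emb c * x) (\<lambda>c x. emb c * x) ((*) y)"
  by unfold_locales (simp_all add: algebra_simps)

lemma span_mult_image: "span ((*) y ` X) = (*) y ` span X"
  using module_hom.span_image[OF module_hom_mult] .

lemma subspace_mult_image: "subspace V \<Longrightarrow> subspace ((*) y ` V)"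
  using module_hom.subspace_image[OF module_hom_mult] .

lemma fin_dim_mult_image:
  assumes "fin_dim V"
  shows "fin_dim ((*) y ` V)"
proof -
  obtain X where "finite X" "V \<subseteq> span X"
    using assms unfolding fin_dim_def by blast
  then have "finite ((*) y ` X)" "(*) y ` V \<subseteq> span ((*) y ` X)"
    by (auto simp: span_mult_image)
  then show ?thesis
    unfolding fin_dim_def by blast
qed

lemma dim_mult_image_le:
  assumes "fin_dim V" "subspace V"
  shows "dim ((*) y ` V) \<le> dim V"
proof -
  obtain X where X: "finite X" "span X = V" "card X = dim V"
    using fin_dim_basis[OF assms] by metis
  have "dim ((*) y ` V) \<le> card ((*) y ` X)"
    using X by (intro dim_le_card) (auto simp: span_mult_image)
  also have "\<dots> \<le> card X"
    using X by (intro card_image_le)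
  finally show ?thesis
    using X by simp
qed

lemma dim_mult_image:
  assumes "fin_dim V" "subspace V" "y \<noteq> 0"
  shows "dim ((*) y ` V) = dim V"
proof -
  have "(*) (inverse y) ` (*) y ` V = V"
    using assms(3) by (simp add: image_image flip: mult.assoc)
  then show ?thesis
    using dim_mult_image_le[OF assms(1,2), of y]
      dim_mult_image_le[OF fin_dim_mult_image[OF assms(1)] subspace_mult_image[OF assms(2)],
        of "inverse y" y]
    by simp
qed

lemma subspace_mult_vimage: "subspace V \<Longrightarrow> subspace {u. u * y \<in> V}"
  using module_hom.subspace_linear_preimage[OF module_hom_mult, of V y] by (simp add: mult.commute)

text \<open>The Dyson transform at \<open>e \<in> U\<close> replaces \<open>(U, R)\<close> by \<open>(U + eR, {r \<in> R. er \<in> U})\<close>. It keeps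
  \<open>UR \<subseteq> A\<close> and \<open>dim U + dim R\<close>, so a pair with \<open>dim U\<close> maximal is fixed by it.\<close>

lemma stable_pair_exists:
  assumes A: "fin_dim A" "subspace A" and U: "subspace U" "U \<subseteq> A" and R: "fin_dim R" "subspace R"
    and UR: "\<And>u r. u \<in> U \<Longrightarrow> r \<in> R \<Longrightarrow> u * r \<in> A"
  obtains S R' where "subspace S" "S \<subseteq> A" "subspace R'" "R' \<subseteq> R"
    "\<And>s r. s \<in> S \<Longrightarrow> r \<in> R' \<Longrightarrow> s * r \<in> S" "dim U + dim R \<le> dim S + dim R'"
proof -
  define Q where "Q = (\<lambda>(S, R'). subspace S \<and> S \<subseteq> A \<and> subspace R' \<and> R' \<subseteq> R \<and>
    (\<forall>s\<in>S. \<forall>r\<in>R'. s * r \<in> A) \<and> dim U + dim R \<le> dim S + dim R')"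
  have "Q (U, R)"
    using U R UR by (simp add: Q_def)
  moreover have "\<forall>p. Q p \<longrightarrow> dim (fst p) < Suc (dim A)"
    using fin_dim_dim_mono[OF A(1)] by (auto simp: Q_def less_Suc_eq_le)
  ultimately have "\<exists>p. Q p \<and> (\<forall>p'. Q p' \<longrightarrow> dim (fst p') \<le> dim (fst p))"
    by (rule ex_has_greatest_nat)
  then obtain S R' where Q: "Q (S, R')" and max: "\<And>S' R''. Q (S', R'') \<Longrightarrow> dim S' \<le> dim S"
    by (metis fst_conv surj_pair)
  have S: "subspace S" "S \<subseteq> A" and R': "subspace R'" "R' \<subseteq> R"
    and SR': "\<And>s r. s \<in> S \<Longrightarrow> r \<in> R' \<Longrightarrow> s * r \<in> A" and dims: "dim U + dim R \<le> dim S + dim R'"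
    using Q by (auto simp: Q_def)
  have finR': "fin_dim R'"
    using R R' fin_dim_subset by blast
  have "e * r \<in> S" if e: "e \<in> S" and r: "r \<in> R'" for e r
  proof (cases "e = 0")
    case True
    then show ?thesis using e by simp
  next
    case False
    define S' where "S' = {u + w | u w. u \<in> S \<and> w \<in> (*) e ` R'}"
    define R'' where "R'' = {r \<in> R'. e * r \<in> S}"
    have sub_S': "subspace S'"
      unfolding S'_def using S R' by (intro subspace_sums subspace_mult_image)
    have S'A: "S' \<subseteq> A"
      using S SR' e subspace_add[OF A(2)] by (fastforce simp: S'_def)
    have "R'' = R' \<inter> {r. r * e \<in> S}"
      by (auto simp: R''_def mult.commute)
    then have sub_R'': "subspace R''"
      using R' subspace_mult_vimage[OF S(1)] subspace_inter by metis
    have S'R'': "s * r \<in> A" if s': "s \<in> S'" and r': "r \<in> R''" for s r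
    proof -
      obtain u q where s: "s = u + e * q" "u \<in> S" "q \<in> R'"
        using s' by (auto simp: S'_def)
      \<comment> \<open>Both terms lie in \<open>A\<close>: \<open>r\<close> was kept in
        \<open>R''\<close> precisely because \<open>e * r\<close> belongs to \<open>S\<close>, so it
        may be multiplied by \<open>q\<close>.\<close>
      have "s * r = u * r + (e * r) * q"
        by (simp add: s algebra_simps)
      moreover have "r \<in> R'" "e * r \<in> S"
        using r' by (auto simp: R''_def)
      ultimately show ?thesis
        using SR' s subspace_add[OF A(2)] by metis
    qed
    \<comment> \<open>The intersection is \<open>eR''\<close>, and multiplication by
      \<open>e \<noteq> 0\<close> preserves dimension, so \<open>S'\<close> gains at least what
      \<open>R'\<close> loses.\<close>
    have "dim S + dim ((*) e ` R') \<le> dim S' + dim (S \<inter> (*) e ` R')"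
    proof (rule dim_add_le_dim_sum_Int)
      show "fin_dim S'"
        using S'A A fin_dim_subset by blast
      show "subspace ((*) e ` R')"
        using R' subspace_mult_image by blast
      have "u + 0 \<in> S'" if "u \<in> S" for u
        using that r subspace_0[OF R'(1)] by (force simp: S'_def)
      then show "S \<subseteq> S'"
        by auto
      have "0 + e * q \<in> S'" if "q \<in> R'" for q
        using that subspace_0[OF S(1)] by (force simp: S'_def)
      then show "(*) e ` R' \<subseteq> S'"
        by auto
    qed (use S in \<open>auto simp: S'_def\<close>)
    moreover have "S \<inter> (*) e ` R' = (*) e ` R''"
      by (auto simp: R''_def)
    moreover have "fin_dim R''"
      using finR' fin_dim_subset by (metis (no_types, lifting) R''_def mem_Collect_eq subsetI)
    ultimately have dims': "dim S + dim R' \<le> dim S' + dim R''"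
      using dim_mult_image False finR' R' sub_R'' by simp
    have "Q (S', R'')"
      using sub_S' S'A sub_R'' S'R'' R' dims dims' by (auto simp: Q_def R''_def)
    then have "dim S' \<le> dim S"
      using max by blast
    moreover have "S \<subseteq> S'"
    proof
      fix u assume "u \<in> S"
      then show "u \<in> S'"
        using subspace_0[OF R'(1)] by (force simp: S'_def)
    qed
    \<comment> \<open>Maximality of \<open>dim S\<close> makes the transform trivial, and then
      \<open>eR'\<close> is contained in \<open>S\<close>.\<close>
    ultimately have "S = S'"
      using fin_dim_subspace_eq[OF fin_dim_subset[OF A(1) S'A] S(1)] by blast
    moreover have "0 + e * r \<in> S'"
      using r subspace_0[OF S(1)] by (force simp: S'_def)
    ultimately show ?thesis
      by simp
  qed
  then show ?thesis
    using that S R' dims by blast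
qed

text \<open>Only inverses need an argument: if \<open>x \<noteq> 0\<close> and \<open>xS\<close> is
  contained in \<open>S\<close>, equality of finite dimensions gives \<open>xS = S\<close>, so
  division by \<open>x\<close> also preserves \<open>S\<close>.\<close>

lemma is_subfield_stabilizer:
  assumes "fin_dim S" "subspace S"
  shows "is_subfield {x. \<forall>s\<in>S. s * x \<in> S}"
proof -
  have "s * inverse x \<in> S" if x: "\<forall>s\<in>S. s * x \<in> S" and s: "s \<in> S" for x s
  proof (cases "x = 0")
    case True
    then show ?thesis using subspace_0[OF assms(2)] by simp
  next
    case False
    have "(*) x ` S \<subseteq> S"
      using x by (auto simp: mult.commute)
    then have "(*) x ` S = S"
      using fin_dim_subspace_eq[OF assms(1) subspace_mult_image[OF assms(2)]]
        dim_mult_image[OF assms False] by simp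
    then obtain t where "t \<in> S" "s = x * t"
      using s by blast
    then show ?thesis
      using False by (simp add: field_simps)
  qed
  then show ?thesis
    using assms(2) by (auto simp: is_subfield_def right_diff_distrib subspace_0 subspace_diff mult.assoc[symmetric])
qed

lemma is_subfield_adjoin: "is_subfield (adjoin emb R)"
  unfolding is_subfield_def adjoin_def by blast

lemma range_subset_adjoin: "range emb \<subseteq> adjoin emb R"
  unfolding adjoin_def by blast

lemma subset_adjoin: "R \<subseteq> adjoin emb R"
  unfolding adjoin_def by blast

text \<open>The stabilizer of \<open>S\<close> is a subfield containing \<open>K\<close> and
  \<open>R\<close>, hence contains \<open>K(R)\<close>.\<close>

lemma mult_adjoin_closed:
  assumes "fin_dim S" "subspace S" "\<And>s r. s \<in> S \<Longrightarrow> r \<in> R \<Longrightarrow> s * r \<in> S"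
    and "s \<in> S" "x \<in> adjoin emb R"
  shows "s * x \<in> S"
proof -
  have "range emb \<union> R \<subseteq> {x. \<forall>s\<in>S. s * x \<in> S}"
    using assms(3) subspace_scale[OF assms(2)] mult.commute[of "emb _"] by auto
  then have "adjoin emb R \<subseteq> {x. \<forall>s\<in>S. s * x \<in> S}"
    using is_subfield_stabilizer[OF assms(1,2)] unfolding adjoin_def by blast
  then show ?thesis
    using assms(4,5) by blast
qed

text \<open>Elements of the summands are traded for coefficients in \<open>F\<close>. As
  \<open>a i = 0\<close> is possible, directness requires \<open>a i * f i = 0\<close> and not
  \<open>f i = 0\<close>.\<close>

lemma direct_sum_mult_iff:
  "direct_sum S I (\<lambda>i. (\<lambda>x. a i * x) ` F) \<longleftrightarrow>
     S = {\<Sum>i\<in>I. a i * f i | f. \<forall>i\<in>I. f i \<in> F} \<and>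
     (\<forall>f. (\<forall>i\<in>I. f i \<in> F) \<and> (\<Sum>i\<in>I. a i * f i) = 0 \<longrightarrow> (\<forall>i\<in>I. a i * f i = 0))"
proof -
  have lift: "\<exists>f. (\<forall>i\<in>I. f i \<in> F) \<and> (\<forall>i\<in>I. x i = a i * f i)"
    if "\<forall>i\<in>I. x i \<in> (\<lambda>x. a i * x) ` F" for x
    using that bchoice[of I "\<lambda>i y. y \<in> F \<and> x i = a i * y"] by blast
  have "{\<Sum>i\<in>I. x i | x. \<forall>i\<in>I. x i \<in> (\<lambda>x. a i * x) ` F} = {\<Sum>i\<in>I. a i * f i | f. \<forall>i\<in>I. f i \<in> F}"
  proof (intro subset_antisym subsetI; clarify)
    fix x assume "\<forall>i\<in>I. x i \<in> (\<lambda>x. a i * x) ` F"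
    then obtain f where "\<forall>i\<in>I. f i \<in> F" "\<forall>i\<in>I. x i = a i * f i"
      using lift by blast
    moreover from this have "(\<Sum>i\<in>I. x i) = (\<Sum>i\<in>I. a i * f i)"
      by (intro sum.cong) auto
    ultimately show "\<exists>f. (\<Sum>i\<in>I. x i) = (\<Sum>i\<in>I. a i * f i) \<and> (\<forall>i\<in>I. f i \<in> F)"
      by blast
  next
    fix f assume "\<forall>i\<in>I. f i \<in> F"
    then show "\<exists>x. (\<Sum>i\<in>I. a i * f i) = (\<Sum>i\<in>I. x i) \<and> (\<forall>i\<in>I. x i \<in> (\<lambda>x. a i * x) ` F)"
      by (intro exI[of _ "\<lambda>i. a i * f i"]) auto
  qed
  moreover have "(\<forall>x. (\<forall>i\<in>I. x i \<in> (\<lambda>x. a i * x) ` F) \<and> (\<Sum>i\<in>I. x i) = 0 \<longrightarrow> (\<forall>i\<in>I. x i = 0)) \<longleftrightarrow>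
      (\<forall>f. (\<forall>i\<in>I. f i \<in> F) \<and> (\<Sum>i\<in>I. a i * f i) = 0 \<longrightarrow> (\<forall>i\<in>I. a i * f i = 0))"
    (is "?l \<longleftrightarrow> ?r")
  proof
    assume l: ?l
    show ?r
    proof (intro allI impI)
      fix f assume "(\<forall>i\<in>I. f i \<in> F) \<and> (\<Sum>i\<in>I. a i * f i) = 0"
      then show "\<forall>i\<in>I. a i * f i = 0"
        using l[rule_format, of "\<lambda>i. a i * f i"] by blast
    qed
  next
    assume r: ?r
    show ?l
    proof (intro allI impI)
      fix x assume x: "(\<forall>i\<in>I. x i \<in> (\<lambda>x. a i * x) ` F) \<and> (\<Sum>i\<in>I. x i) = 0"
      then obtain f where f: "\<forall>i\<in>I. f i \<in> F" "\<forall>i\<in>I. x i = a i * f i"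
        using lift by blast
      then have "(\<Sum>i\<in>I. x i) = (\<Sum>i\<in>I. a i * f i)"
        by (intro sum.cong) auto
      then have "(\<Sum>i\<in>I. a i * f i) = 0"
        using x by simp
      then show "\<forall>i\<in>I. x i = 0"
        using r f by simp
    qed
  qed
  ultimately show ?thesis
    unfolding direct_sum_def by simp
qed

text \<open>This is the existence of an \<open>F\<close>-basis of \<open>S\<close>. Its maximality
  argument measures \<open>F\<close>-spans by their dimension over \<open>K\<close>, which
  \<open>dim S\<close> bounds.\<close>

lemma direct_sum_over_subfield_exists:
  assumes F: "is_subfield F" "range emb \<subseteq> F" and S: "fin_dim S" "subspace S"
    and SF: "\<And>s x. s \<in> S \<Longrightarrow> x \<in> F \<Longrightarrow> s * x \<in> S"
  shows "\<exists>(m::nat) a. (\<forall>i\<in>{1..m}. a i \<in> S) \<and> direct_sum S {1..m} (\<lambda>i. (\<lambda>x. a i * x) ` F)"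
proof -
  \<comment> \<open>A pair \<open>(m, a)\<close> stands for a finite sequence: \<open>T\<close> is
    its \<open>F\<close>-span, and \<open>Q\<close> says that it lies in \<open>S\<close> and that
    its \<open>F\<close>-multiples form a direct sum.\<close>
  define T where "T = (\<lambda>(m::nat, a). {\<Sum>i\<in>{1..m}. a i * f i | f. \<forall>i\<in>{1..m}. f i \<in> F})"
  define Q where "Q = (\<lambda>(m::nat, a). (\<forall>i\<in>{1..m}. a i \<in> S) \<and>
    (\<forall>f. (\<forall>i\<in>{1..m}. f i \<in> F) \<and> (\<Sum>i\<in>{1..m}. a i * f i) = 0 \<longrightarrow> (\<forall>i\<in>{1..m}. a i * f i = 0)))"
  have F_closed: "0 \<in> F" "1 \<in> F" "\<And>x y. x \<in> F \<Longrightarrow> y \<in> F \<Longrightarrow> x * y \<in> F" "\<And>x. x \<in> F \<Longrightarrow> inverse x \<in> F"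
    "\<And>x y. x \<in> F \<Longrightarrow> y \<in> F \<Longrightarrow> x - y \<in> F" "\<And>c. emb c \<in> F"
    using F by (auto simp: is_subfield_def)
  have F_neg: "- x \<in> F" if "x \<in> F" for x
    using F_closed(5)[OF F_closed(1) that] by simp
  have F_add: "x + y \<in> F" if "x \<in> F" "y \<in> F" for x y
    using F_closed(5)[OF that(1) F_neg[OF that(2)]] by simp
  have T_memI: "(\<Sum>i\<in>{1..m}. a i * f i) \<in> T (m, a)" if "\<forall>i\<in>{1..m}. f i \<in> F" for m a f
    using that by (auto simp: T_def)
  have T_mult: "t * x \<in> T p" if t: "t \<in> T p" and x: "x \<in> F" for t x p
  proof -
    obtain m a where p: "p = (m, a)"
      by (cases p)
    obtain f where f: "t = (\<Sum>i\<in>{1..m}. a i * f i)" "\<forall>i\<in>{1..m}. f i \<in> F"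
      using t by (auto simp: T_def p)
    have "t * x = (\<Sum>i\<in>{1..m}. a i * (f i * x))"
      by (simp add: f sum_distrib_right mult.assoc)
    then show ?thesis
      using T_memI[of m "\<lambda>i. f i * x" a] f x F_closed(3) p by simp
  qed
  have sub_T: "subspace (T p)" for p
  proof (rule subspaceI)
    obtain m a where p: "p = (m, a)"
      by (cases p)
    show "0 \<in> T p"
      using T_memI[of m "\<lambda>_. 0" a] F_closed by (simp add: p)
    show "s + t \<in> T p" if s: "s \<in> T p" and t: "t \<in> T p" for s t
    proof -
      obtain f where f: "s = (\<Sum>i\<in>{1..m}. a i * f i)" "\<forall>i\<in>{1..m}. f i \<in> F"
        using s by (auto simp: T_def p)
      obtain g where g: "t = (\<Sum>i\<in>{1..m}. a i * g i)" "\<forall>i\<in>{1..m}. g i \<in> F"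
        using t by (auto simp: T_def p)
      have "s + t = (\<Sum>i\<in>{1..m}. a i * (f i + g i))"
        by (simp add: f g distrib_left sum.distrib)
      then show ?thesis
        using T_memI[of m "\<lambda>i. f i + g i" a] f g F_add by (simp add: p)
    qed
    show "emb c * t \<in> T p" if "t \<in> T p" for c t
      using T_mult[OF that F_closed(6)] by (simp add: mult.commute)
  qed
  have T_sub: "T p \<subseteq> S" if "Q p" for p
  proof
    fix t assume "t \<in> T p"
    moreover obtain m a where p: "p = (m, a)"
      by (cases p)
    ultimately obtain f where f: "t = (\<Sum>i\<in>{1..m}. a i * f i)" "\<forall>i\<in>{1..m}. f i \<in> F"
      by (auto simp: T_def)
    moreover have "\<forall>i\<in>{1..m}. a i \<in> S"
      using that by (simp add: Q_def p)
    ultimately show "t \<in> S"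
      using SF S(2) by (auto intro!: subspace_sum)
  qed
  have "Q (0, \<lambda>_. 0)"
    by (simp add: Q_def)
  moreover have "\<forall>p. Q p \<longrightarrow> dim (T p) < Suc (dim S)"
    using fin_dim_dim_mono[OF S(1) T_sub] by (simp add: less_Suc_eq_le)
  ultimately have "\<exists>p. Q p \<and> (\<forall>p'. Q p' \<longrightarrow> dim (T p') \<le> dim (T p))"
    by (rule ex_has_greatest_nat)
  then obtain m a where Q: "Q (m, a)" and max: "\<And>p'. Q p' \<Longrightarrow> dim (T p') \<le> dim (T (m, a))"
    by (metis surj_pair)
  have "T (m, a) = S"
  proof (rule ccontr)
    assume "T (m, a) \<noteq> S"
    then obtain s where s: "s \<in> S" "s \<notin> T (m, a)"
      using T_sub[OF Q] by blast
    define b where "b = a(Suc m := s)"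
    have b_sum: "(\<Sum>i\<in>{1..Suc m}. b i * f i) = (\<Sum>i\<in>{1..m}. a i * f i) + s * f (Suc m)" for f
    proof -
      have "(\<Sum>i\<in>{1..m}. b i * f i) = (\<Sum>i\<in>{1..m}. a i * f i)"
        by (intro sum.cong) (auto simp: b_def)
      then show ?thesis
        by (simp add: b_def)
    qed
    have "Q (Suc m, b)"
    proof -
      have "b i \<in> S" if "i \<in> {1..Suc m}" for i
        using that Q s by (auto simp: b_def Q_def)
      moreover have "\<forall>i\<in>{1..Suc m}. b i * f i = 0"
        if f: "\<forall>i\<in>{1..Suc m}. f i \<in> F" "(\<Sum>i\<in>{1..Suc m}. b i * f i) = 0" for f
      proof -
        have f': "\<forall>i\<in>{1..m}. f i \<in> F" "f (Suc m) \<in> F"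
          using f by auto
        have "f (Suc m) = 0"
        proof (rule ccontr)
          \<comment> \<open>Dividing the relation by the coefficient of \<open>s\<close> would put
            \<open>s\<close> into the span of the earlier terms.\<close>
          assume nz: "f (Suc m) \<noteq> 0"
          have "s * f (Suc m) = - (\<Sum>i\<in>{1..m}. a i * f i)"
            using f(2) unfolding b_sum by (simp add: eq_neg_iff_add_eq_0 add.commute)
          then have "s = (\<Sum>i\<in>{1..m}. a i * f i) * (- inverse (f (Suc m)))"
            using nz by (simp add: field_simps)
          then show False
            using s(2) T_mult[OF T_memI[OF f'(1)] F_neg[OF F_closed(4)[OF f'(2)]], of a] by simp
        qed
        moreover from this have "(\<Sum>i\<in>{1..m}. a i * f i) = 0"
          using f(2) unfolding b_sum by simp
        then have "\<forall>i\<in>{1..m}. a i * f i = 0"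
          using Q f'(1) by (simp add: Q_def)
        ultimately show ?thesis
          by (auto simp: b_def le_Suc_eq)
      qed
      ultimately show ?thesis
        by (simp add: Q_def)
    qed
    moreover have "T (m, a) \<subseteq> T (Suc m, b)"
    proof
      fix t assume "t \<in> T (m, a)"
      then obtain f where f: "t = (\<Sum>i\<in>{1..m}. a i * f i)" "\<forall>i\<in>{1..m}. f i \<in> F"
        by (auto simp: T_def)
      have "(\<Sum>i\<in>{1..m}. a i * (f(Suc m := 0)) i) = t"
        unfolding f(1) by (intro sum.cong) auto
      then have "(\<Sum>i\<in>{1..Suc m}. b i * (f(Suc m := 0)) i) = t"
        unfolding b_sum by simp
      moreover have "\<forall>i\<in>{1..Suc m}. (f(Suc m := 0)) i \<in> F"
        using f(2) F_closed(1) by auto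
      ultimately show "t \<in> T (Suc m, b)"
        using T_memI by metis
    qed
    moreover have "s \<in> T (Suc m, b)"
    proof -
      let ?f = "\<lambda>i. if i = Suc m then 1 else 0"
      have "(\<Sum>i\<in>{1..m}. a i * ?f i) = 0"
        by (intro sum.neutral) auto
      then have "(\<Sum>i\<in>{1..Suc m}. b i * ?f i) = s"
        unfolding b_sum by simp
      then show ?thesis
        using T_memI[of "Suc m" ?f b] F_closed by (auto split: if_splits)
    qed
    ultimately have "dim (T (m, a)) < dim (T (Suc m, b))"
      using fin_dim_dim_insert_less[OF fin_dim_subset[OF S(1) T_sub] sub_T] s(2) by blast
    then show False
      using max \<open>Q (Suc m, b)\<close> by (meson leD)
  qed
  then have "direct_sum S {1..m} (\<lambda>i. (\<lambda>x. a i * x) ` F)"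
    using Q unfolding direct_sum_mult_iff by (simp add: T_def Q_def)
  moreover have "\<forall>i\<in>{1..m}. a i \<in> S"
    using Q by (simp add: Q_def)
  ultimately show ?thesis
    by blast
qed


section \<open>Partial matchings\<close>

lemma ordered_basis_extend:
  assumes V: "fin_dim V" "subspace V" "dim V = n" and U: "subspace U" "U \<subseteq> V"
  obtains a J where "ordered_basis emb n a V" "J \<subseteq> {1..n}" "card J = dim U" "a ` J \<subseteq> U"
proof -
  obtain X where X: "X \<subseteq> U" "independent X" "card X = dim U"
    using fin_dim_basis[OF fin_dim_subset[OF V(1) U(2)] U(1)] by metis
  obtain T where T: "X \<subseteq> T" "independent T" "finite T" "span T = V" "card T = n"
    using fin_dim_basis_extend[OF V(1,2), of X] X U V(3) by (metis subset_trans)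
  obtain a where a: "bij_betw a {1..n} T"
    using ex_bij_betw_nat_finite_1[OF T(3)] T(5) by blast
  define J where "J = {i \<in> {1..n}. a i \<in> X}"
  have aJ: "a ` J = X"
    using a T(1) by (auto simp: J_def bij_betw_def)
  have "inj_on a J"
    by (rule inj_on_subset[OF bij_betw_imp_inj_on[OF a]]) (auto simp: J_def)
  then have "card J = dim U"
    using card_image[of a J] aJ X(3) by simp
  moreover have "ordered_basis emb n a V"
    using a T by (simp add: ordered_basis_def bij_betw_def)
  moreover have "J \<subseteq> {1..n}"
    by (auto simp: J_def)
  ultimately show ?thesis
    using that[of a J] aJ X(1) by blast
qed

text \<open>Choose a basis of \<open>A\<close> with \<open>dim S\<close> members, indexed by
  \<open>J\<close>, in \<open>S\<close>. For \<open>i\<close> in \<open>P \<inter> J\<close> the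
  space \<open>a\<^sub>i\<^sup>-\<^sup>1A \<inter> B\<close> contains \<open>R\<close>, so the
  coordinate at \<open>b i\<close> vanishes on \<open>R\<close>. Hence
  \<open>dim R \<le> n - card (P \<inter> J)\<close>, where \<open>card (P \<inter> J)\<close> is at
  least \<open>dim S - d\<close>.\<close>

lemma not_partially_matched_if_stable_pair:
  assumes A: "fin_dim A" "subspace A" "dim A = n" and S: "subspace S" "S \<subseteq> A" and R: "R \<subseteq> B"
    and SR: "\<And>s r. s \<in> S \<Longrightarrow> r \<in> R \<Longrightarrow> s * r \<in> A" and dims: "n + d < dim S + dim R"
  shows "\<not> partially_matched emb n A B d"
proof
  assume match: "partially_matched emb n A B d"
  obtain a J where a: "ordered_basis emb n a A" and J: "J \<subseteq> {1..n}" "card J = dim S" "a ` J \<subseteq> S"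
    using ordered_basis_extend[OF A S] by metis
  obtain b where b: "ordered_basis emb n b B" and "partially_matched_bases emb n A B a b d"
    using match a by (auto simp: partially_matched_def)
  then obtain P where P: "P \<subseteq> {1..n}" "card P = n - d"
    and sub: "\<forall>i\<in>P. (\<lambda>x. inverse (a i) * x) ` A \<inter> B \<subseteq> span (b ` ({1..n} - {i}))"
    by (auto simp: partially_matched_bases_def)
  have fin: "finite P" "finite J"
    using finite_subset[OF P(1)] finite_subset[OF J(1)] by auto
  have inj: "inj_on b {1..n}" and indep: "independent (b ` {1..n})" and span: "span (b ` {1..n}) = B"
    using b by (auto simp: ordered_basis_def)
  have "R \<subseteq> span (b ` {1..n} - b ` (P \<inter> J))"
  proof
    fix r assume r: "r \<in> R"
    show "r \<in> span (b ` {1..n} - b ` (P \<inter> J))"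
    proof (rule mem_span_Diff[OF indep])
      show "r \<in> span (b ` {1..n})"
        using r R span by blast
      fix y assume "y \<in> b ` (P \<inter> J)"
      then obtain i where i: "i \<in> P" "i \<in> J" "y = b i"
        by blast
      have "a i \<in> a ` {1..n}"
        using i P by blast
      then have "a i \<noteq> 0"
        using a dependent_zero by (metis ordered_basis_def)
      then have "r = inverse (a i) * (a i * r)"
        by simp
      moreover have "a i * r \<in> A"
        using i J SR r by blast
      ultimately have "r \<in> span (b ` ({1..n} - {i}))"
        using bspec[OF sub i(1)] r R by blast
      also have "b ` ({1..n} - {i}) = b ` {1..n} - {y}"
        using i P by (subst inj_on_image_set_diff[OF inj]) auto
      finally show "r \<in> span (b ` {1..n} - {y})" .
    qed
  qed
  then have "dim R \<le> card (b ` {1..n} - b ` (P \<inter> J))"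
    by (intro dim_le_card) auto
  also have "b ` {1..n} - b ` (P \<inter> J) = b ` ({1..n} - P \<inter> J)"
    using inj J by (subst inj_on_image_set_diff[OF inj]) auto
  also have "card \<dots> \<le> card ({1..n} - P \<inter> J)"
    by (intro card_image_le) auto
  also have "\<dots> = n - card (P \<inter> J)"
    using J fin by (subst card_Diff_subset) auto
  finally have "dim R \<le> n - card (P \<inter> J)" .
  moreover have "card (P \<inter> J) \<le> n"
    using card_mono[of "{1..n}" "P \<inter> J"] J by auto
  moreover have "card P + card J = card (P \<union> J) + card (P \<inter> J)"
    using fin by (rule card_Un_Int)
  moreover have "card (P \<union> J) \<le> n"
    using card_mono[of "{1..n}" "P \<union> J"] P J by auto
  \<comment> \<open>This makes the truncated difference in \<open>card P = n - d\<close>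
    exact.\<close>
  moreover have "d \<le> n"
    using match by (simp add: partially_matched_def)
  ultimately show False
    using dims P(2) J(2) by linarith
qed

text \<open>An unmatchable basis \<open>a\<close> violates Rado's condition at some
  \<open>J\<close>. Take \<open>U\<close> spanned by the \<open>a i\<close> with \<open>i\<close> in
  \<open>J\<close>, and \<open>R\<close> the common part of the corresponding
  \<open>a\<^sub>i\<^sup>-\<^sup>1A \<inter> B\<close>. The bound \<open>l \<le> n\<close> ensures
  that the failure comes from a basis and not from the range allowed for defects.\<close>

lemma pair_exists_if_not_partially_matched:
  assumes A: "subspace A" and B: "fin_dim B" "subspace B" "dim B = n"
    and l: "l \<le> n" and not_match: "\<not> partially_matched emb n A B l"
  obtains U R where "subspace U" "U \<subseteq> A" "subspace R" "R \<subseteq> B"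
    "\<And>u r. u \<in> U \<Longrightarrow> r \<in> R \<Longrightarrow> u * r \<in> A" "n + l < dim U + dim R"
proof -
  obtain a where a: "ordered_basis emb n a A"
    and no_b: "\<And>b. ordered_basis emb n b B \<Longrightarrow> \<not> partially_matched_bases emb n A B a b l"
    using not_match l unfolding partially_matched_def by blast
  have a_inj: "inj_on a {1..n}" and a_indep: "independent (a ` {1..n})" and a_span: "span (a ` {1..n}) = A"
    using a by (auto simp: ordered_basis_def)
  define V where "V i = (\<lambda>x. inverse (a i) * x) ` A \<inter> B" for i
  have V: "\<forall>i\<in>{1..n}. subspace (V i) \<and> V i \<subseteq> B"
    using subspace_inter[OF subspace_mult_image[OF A] B(2)] by (simp add: V_def)
  have "\<not> rado_family B {1..n} l V"
  proof
    assume "rado_family B {1..n} l V"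
    then obtain b P where b: "inj_on b {1..n}" "independent (b ` {1..n})" "span (b ` {1..n}) = B"
      and P: "P \<subseteq> {1..n}" "card P = dim B - l" "\<And>i. i \<in> P \<Longrightarrow> V i \<subseteq> span (b ` ({1..n} - {i}))"
      using rado_hyperplanes[OF B(1,2), of "{1..n}" l V] B(3) by auto
    have "ordered_basis emb n b B"
      using b by (simp add: ordered_basis_def)
    moreover have "partially_matched_bases emb n A B a b l"
      unfolding partially_matched_bases_def
      using P B(3) by (intro exI[of _ P]) (simp add: V_def)
    ultimately show False
      using no_b by blast
  qed
  then obtain J where J: "J \<subseteq> {1..n}" "\<not> dim (B \<inter> (\<Inter>i\<in>J. V i)) + card J \<le> card {1..n} + l"
    using V unfolding rado_family_def by blast
  define R where "R = B \<inter> (\<Inter>i\<in>J. V i)"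
  have "u * r \<in> A" if u: "u \<in> span (a ` J)" and r: "r \<in> R" for u r
  proof -
    have "a i * r \<in> A" if i: "i \<in> J" for i
    proof -
      obtain y where "y \<in> A" "r = inverse (a i) * y"
        using r i unfolding R_def V_def by blast
      moreover have "a i \<in> a ` {1..n}"
        using i J by blast
      then have "a i \<noteq> 0"
        using a_indep dependent_zero by metis
      ultimately show ?thesis
        by (simp flip: mult.assoc)
    qed
    then have "span (a ` J) \<subseteq> {u. u * r \<in> A}"
      using subspace_mult_vimage[OF A] by (intro span_minimal) auto
    then show ?thesis
      using u by blast
  qed
  moreover have "span (a ` J) \<subseteq> A"
    using a_span span_mono[OF image_mono[OF J(1)], of a] by simp
  moreover have "subspace R"
    using V J(1) unfolding R_def by (intro subspace_inter B(2) subspace_Int) auto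
  moreover have "dim (span (a ` J)) = card J"
  proof -
    have "independent (a ` J)"
      using independent_mono[OF a_indep image_mono[OF J(1)]] .
    then show ?thesis
      using card_image[OF inj_on_subset[OF a_inj J(1)]] by (simp add: dim_eq_card_independent)
  qed
  then have "n + l < dim (span (a ` J)) + dim R"
    using J(2) by (simp add: R_def)
  ultimately show ?thesis
    using that[of "span (a ` J)" R] by (auto simp: R_def)
qed

text \<open>Defect \<open>n\<close> allows \<open>P = {}\<close>, so the least element in
  \<open>deficiency\<close> exists.\<close>

lemma partially_matched_full_defect:
  assumes "fin_dim B" "subspace B" "dim B = n"
  shows "partially_matched emb n A B n"
proof -
  obtain b where "ordered_basis emb n b B"
    using ordered_basis_extend[OF assms assms(2) subset_refl] by metis
  moreover have "partially_matched_bases emb n A B a b n" for a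
    unfolding partially_matched_bases_def by (intro exI[of _ "{}"]) simp
  ultimately show ?thesis
    by (auto simp: partially_matched_def)
qed

end

section \<open>Deficiency and decompositions over \<open>K(R)\<close>\<close>

theorem theorem4p1:
  fixes emb :: "'k::field \<Rightarrow> 'l::field"
    and A B :: "'l set" and n l :: nat
  assumes "field_extension emb" and "range emb \<subset> UNIV"
    and "K_subspace emb A" and "K_subspace emb B"
    and "0 < n" and "K_dim emb A = n" and "K_dim emb B = n"
    and "1 \<notin> B"
  shows "deficiency emb A B > l \<longleftrightarrow>
    (\<exists>R S Y Z. K_subspace emb R \<and> R \<noteq> {0} \<and> R \<subseteq> B \<and>
       K_subspace emb S \<and> K_subspace emb Y \<and> K_subspace emb Z \<and>
       direct_sum2 A S Y \<and> direct_sum2 B R Z \<and>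
       int (K_dim emb Y) < int (K_dim emb R) - int l \<and>
       (\<exists>(m::nat) a. (\<forall>i\<in>{1..m}. a i \<in> S) \<and>
          direct_sum S {1..m} (\<lambda>i. (\<lambda>x. a i * x) ` adjoin emb R)))"
    (is "_ \<longleftrightarrow> ?rhs")
proof -
  interpret field_extension emb
    by fact
  note A = assms(3) and B = assms(4)
  have finA: "fin_dim A" and finB: "fin_dim B"
    using assms(5,6,7) by (auto intro: fin_dim_if_dim_pos)
  have match_n: "partially_matched emb n A B n"
    using finB B assms(7) by (rule partially_matched_full_defect)
  show ?thesis
  proof
    assume gt: "deficiency emb A B > l"
    then have "\<not> partially_matched emb n A B l"
      using not_less_Least[of l "partially_matched emb n A B"] assms(6) by (simp add: deficiency_def)
    moreover have "deficiency emb A B \<le> n"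
      using Least_le[of "partially_matched emb n A B", OF match_n] assms(6) by (simp add: deficiency_def)
    then have "l \<le> n"
      using gt by simp
    ultimately obtain U R\<^sub>0 where U: "subspace U" "U \<subseteq> A" and R\<^sub>0: "subspace R\<^sub>0" "R\<^sub>0 \<subseteq> B"
      and UR: "\<And>u r. u \<in> U \<Longrightarrow> r \<in> R\<^sub>0 \<Longrightarrow> u * r \<in> A" and dims\<^sub>0: "n + l < dim U + dim R\<^sub>0"
      using pair_exists_if_not_partially_matched[OF A finB B assms(7)] by metis
    have "fin_dim R\<^sub>0"
      using finB R\<^sub>0 fin_dim_subset by blast
    then obtain S R where S: "subspace S" "S \<subseteq> A" and R: "subspace R" "R \<subseteq> R\<^sub>0"
      and SR: "\<And>s r. s \<in> S \<Longrightarrow> r \<in> R \<Longrightarrow> s * r \<in> S" and "dim U + dim R\<^sub>0 \<le> dim S + dim R"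
      using stable_pair_exists[OF finA A U _ R\<^sub>0(1) UR] by metis
    then have dims: "n + l < dim S + dim R" and RB: "R \<subseteq> B"
      using dims\<^sub>0 R\<^sub>0 by auto
    have finS: "fin_dim S"
      using finA S fin_dim_subset by blast
    obtain Y where Y: "subspace Y" "A = {u + w | u w. u \<in> S \<and> w \<in> Y}" "S \<inter> Y = {0}"
      "dim S + dim Y = dim A"
      by (rule subspace_complement[OF finA A S])
    obtain Z where Z: "subspace Z" "B = {u + w | u w. u \<in> R \<and> w \<in> Z}" "R \<inter> Z = {0}"
      "dim R + dim Z = dim B"
      by (rule subspace_complement[OF finB B R(1) RB])
    \<comment> \<open>With \<open>n + l < dim S + dim R\<close> this forces
      \<open>dim R > l\<close>, so \<open>R\<close> is nonzero.\<close>
    have "dim S \<le> n"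
      using fin_dim_dim_mono[OF finA S(2)] assms(6) by simp
    moreover have "dim {0} = 0"
      using dim_le_card[of "{0}" "{}"] by simp
    ultimately have "R \<noteq> {0}"
      using dims by auto
    \<comment> \<open>Since \<open>dim Y = n - dim S\<close>, this is
      \<open>n + l < dim S + dim R\<close> rearranged.\<close>
    moreover have "int (dim Y) < int (dim R) - int l"
      using dims Y(4) assms(6) by simp
    moreover have "\<exists>(m::nat) a. (\<forall>i\<in>{1..m}. a i \<in> S) \<and>
        direct_sum S {1..m} (\<lambda>i. (\<lambda>x. a i * x) ` adjoin emb R)"
      using mult_adjoin_closed[OF finS S(1) SR]
      by (intro direct_sum_over_subfield_exists is_subfield_adjoin range_subset_adjoin finS S(1)) blast
    moreover have "direct_sum2 A S Y" "direct_sum2 B R Z"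
      using Y Z by (simp_all add: direct_sum2_def)
    ultimately show ?rhs
      using R RB S Y(1) Z(1) by blast
  next
    assume ?rhs
    then obtain R S Y m and a :: "nat \<Rightarrow> 'l" where R: "R \<subseteq> B" and S: "subspace S" and Y: "subspace Y"
      and AY: "direct_sum2 A S Y" and dims: "int (dim Y) < int (dim R) - int l"
      and sum: "direct_sum S {1..m} (\<lambda>i. (\<lambda>x. a i * x) ` adjoin emb R)"
      by blast
    have S_eq: "S = {\<Sum>i\<in>{1..m}. a i * f i | f. \<forall>i\<in>{1..m}. f i \<in> adjoin emb R}"
      using sum direct_sum_mult_iff by blast
    have A_eq: "A = {u + w | u w. u \<in> S \<and> w \<in> Y}"
      using AY by (simp add: direct_sum2_def)
    have SA: "S \<subseteq> A"
    proof
      fix s assume "s \<in> S"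
      then have "s + 0 \<in> A"
        using subspace_0[OF Y] unfolding A_eq by blast
      then show "s \<in> A"
        by simp
    qed
    have YA: "Y \<subseteq> A"
    proof
      fix y assume "y \<in> Y"
      then have "0 + y \<in> A"
        using subspace_0[OF S] unfolding A_eq by blast
      then show "y \<in> A"
        by simp
    qed
    \<comment> \<open>Multiplying by \<open>r\<close> only changes the coefficients within
      \<open>K(R)\<close>, so the product even stays in \<open>S\<close>.\<close>
    have SR: "s * r \<in> A" if "s \<in> S" and r: "r \<in> R" for s r
    proof -
      obtain f where f: "s = (\<Sum>i\<in>{1..m}. a i * f i)" "\<forall>i\<in>{1..m}. f i \<in> adjoin emb R"
        using \<open>s \<in> S\<close> unfolding S_eq by blast
      have "s * r = (\<Sum>i\<in>{1..m}. a i * (f i * r))"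
        by (simp add: f sum_distrib_right mult.assoc)
      moreover have "\<forall>i\<in>{1..m}. f i * r \<in> adjoin emb R"
        using f(2) r subset_adjoin is_subfield_adjoin[of R] unfolding is_subfield_def by blast
      ultimately have "s * r \<in> S"
        unfolding S_eq mem_Collect_eq by (intro exI[of _ "\<lambda>i. f i * r"] conjI)
      then show ?thesis
        using SA by blast
    qed
    have "dim A \<le> dim S + dim Y"
      using dim_sum_le[OF fin_dim_subset[OF finA SA] fin_dim_subset[OF finA YA] S Y] A_eq by simp
    \<comment> \<open>One pair rules out every defect up to \<open>l\<close>; the deficiency is
      itself an attained defect, so it exceeds \<open>l\<close>.\<close>
    then have "n + d < dim S + dim R" if "d \<le> l" for d
      using dims assms(6) that by linarith
    then have "\<not> partially_matched emb n A B d" if "d \<le> l" for d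
      using not_partially_matched_if_stable_pair[OF finA A assms(6) S SA R SR] that by blast
    moreover have "partially_matched emb n A B (deficiency emb A B)"
      using LeastI[of "partially_matched emb n A B", OF match_n] assms(6) by (simp add: deficiency_def)
    ultimately show "deficiency emb A B > l"
      using not_less by blast
  qed
qed

end
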